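(* Let $n=2^m$, where $m$ is an integer with $m\ge 2$. Let $C$ be a binary $[n,k]$ code and let $a$ be a positive integer with $0<a<n/2$ such that (i) $\{i\in\{0,1,\ldots,n\}\mid A_i(C)\ne 0\}=\{0,\,n/2-a,\,n/2,\,n/2+a,\,n\}$, and (ii) $C$ contains the first order Reed--Muller code $RM(1,m)$ as a subcode. Put $l=\left(\frac{n}{2a}\right)^2$. Then the weight distribution of $C$ is given by $$A_0(C)=1,\qquad A_{n/2-a}(C)=(2^{k-m-1}-1)\,l,\qquad A_{n/2}(C)=2n-2+(2^{k-m-1}-1)(2n-2l),$$ $$A_{n/2+a}(C)=(2^{k-m-1}-1)\,l,\qquad A_n(C)=1.$$
   Context: A binary $[n,k]$ code is a $k$-dimensional vector subspace of $\mathbb{F}_2^n$. The weight $\mathrm{wt}(x)$ of a vector $x$ is its number of non-zero coordinates, and $A_i(C)$ denotes the number of codewords of weight $i$ in $C$. The first order Reed--Muller codes $RM(1,m)\subset\mathbb{F}_2^{2^m}$ are defined recursively by $RM(1,1)=\mathbb{F}_2^2$ and, for $m>1$, $RM(1,m)=\{(u,u),(u,u+\mathbf{1})\in\mathbb{F}_2^{2^m}\mid u\in RM(1,m-1)\}$, where $\mathbf{1}$ denotes the all-one vector of suitable length. *)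

theory Defs
  imports "HOL-Library.Z2" "Jordan_Normal_Form.VS_Connect"
begin

text \<open>The field with two elements is the type \<^typ>\<open>bit\<close>, and the ambient space of
  binary words of length \<open>n\<close> is the vector space \<open>module_vec TYPE(bit) n\<close> with carrier
  \<open>carrier_vec n\<close>.\<close>

definition binary_code :: "nat \<Rightarrow> nat \<Rightarrow> bit vec set \<Rightarrow> bool" where
  "binary_code n k C \<longleftrightarrow>
     VectorSpace.subspace class_ring C (module_vec TYPE(bit) n) \<and>
     vectorspace.dim class_ring ((module_vec TYPE(bit) n)\<lparr>carrier := C\<rparr>) = k"

definition wt :: "bit vec \<Rightarrow> nat" where
  "wt x = card {i. i < dim_vec x \<and> x $ i \<noteq> 0}"

definition num_words :: "bit vec set \<Rightarrow> nat \<Rightarrow> nat" where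
  "num_words C i = card {x \<in> C. wt x = i}"

definition all_one_vec :: "nat \<Rightarrow> bit vec" where
  "all_one_vec n = vec n (\<lambda>_. 1)"

text \<open>The recursion for \<open>RM(1,m)\<close> starts at \<open>m = 1\<close>; the value at \<open>0\<close> is the usual
  convention \<open>RM(1,0) = F\<^sub>2\<close> and is not used by the recursion.\<close>

fun RM1 :: "nat \<Rightarrow> bit vec set" where
  "RM1 0 = carrier_vec 1"
| "RM1 (Suc 0) = carrier_vec 2"
| "RM1 (Suc (Suc m)) =
     {u @\<^sub>v u | u. u \<in> RM1 (Suc m)} \<union>
     {u @\<^sub>v (u + all_one_vec (2 ^ Suc m)) | u. u \<in> RM1 (Suc m)}"

end

theory Submission
  imports Defs
begin

text \<open>The code \<open>RM(1,m)\<close> contains the all-one word and separates any two coordinates \<open>i \<noteq> j\<close>.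
  Hence translating by a codeword \<open>r\<close> with \<open>r\<^sub>i \<noteq> r\<^sub>j\<close> shows that the sum of
  \<open>(-1)\<^bsup>x\<^sub>i + x\<^sub>j\<^esup>\<close> over \<open>x \<in> C\<close> vanishes. Expanding
  \<open>n - 2 wt x = (\<Sum>i<n. (-1)\<^bsup>x\<^sub>i\<^esup>)\<close>, only the diagonal terms survive in the second moment:
  the sum of \<open>(n - 2 wt x)\<^sup>2\<close> over \<open>C\<close> is \<open>n |C| = n 2\<^sup>k\<close>. Together with the total count
  and the symmetry \<open>A\<^sub>i = A\<^bsub>n-i\<^esub>\<close> coming from adding the all-one word, this determines the
  weight distribution.\<close>

section \<open>Binary codes as finite vector spaces\<close>

lemma (in vectorspace) card_carrier_eq_power_dim:
  assumes "fin_dim"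
  shows "card (carrier V) = card (carrier K) ^ dim"
proof -
  obtain B where B: "finite B" "basis B"
    using finite_basis_exists[OF assms] by blast
  then have BV: "B \<subseteq> carrier V"
    by (simp add: basis_def)
  have ex1: "\<forall>v\<in>carrier V. \<exists>!c. c \<in> B \<rightarrow>\<^sub>E carrier K \<and> lincomb c B = v"
    using basis_criterion[OF B(1) BV] B(2) by blast
  have closed: "lincomb c B \<in> carrier V" if "c \<in> B \<rightarrow>\<^sub>E carrier K" for c
    using that BV by (intro lincomb_closed) auto
  \<comment> \<open>Vectors correspond to their coordinates in the basis \<open>B\<close>.
    Extensional coefficient functions make the coordinates unique and countable.\<close>
  have "bij_betw (\<lambda>c. lincomb c B) (B \<rightarrow>\<^sub>E carrier K) (carrier V)"
    unfolding bij_betw_def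
  proof
    show "inj_on (\<lambda>c. lincomb c B) (B \<rightarrow>\<^sub>E carrier K)"
      using ex1 closed by (metis (no_types, lifting) inj_onI)
    show "(\<lambda>c. lincomb c B) ` (B \<rightarrow>\<^sub>E carrier K) = carrier V"
      using ex1 closed by blast
  qed
  then have "card (carrier V) = card (B \<rightarrow>\<^sub>E carrier K)"
    by (simp add: bij_betw_same_card)
  also have "\<dots> = card (carrier K) ^ dim"
    using B by (simp add: card_funcsetE dim_basis)
  finally show ?thesis .
qed

lemma UNIV_bit: "(UNIV :: bit set) = {0, 1}"
  by (auto intro: bit.exhaust)

lemma finite_carrier_vec_bit: "finite (carrier_vec n :: bit vec set)"
proof (rule finite_subset)
  show "carrier_vec n \<subseteq> vec_of_list ` {xs :: bit list. set xs \<subseteq> UNIV \<and> length xs = n}"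
    by (metis (mono_tags, lifting) carrier_vecD imageI length_list_of_vec mem_Collect_eq
        subsetI subset_UNIV vec_list)
  show "finite (vec_of_list ` {xs :: bit list. set xs \<subseteq> UNIV \<and> length xs = n})"
    by (intro finite_imageI finite_lists_length_eq) (simp add: UNIV_bit)
qed

lemma binary_code_submodule:
  assumes "binary_code n k C"
  shows "submodule class_ring C (module_vec TYPE(bit) n)"
  using assms by (simp only: binary_code_def subspace_def)

lemma binary_code_subset:
  assumes "binary_code n k C"
  shows "C \<subseteq> carrier_vec n"
  using submodule.subset[OF binary_code_submodule[OF assms]] by (simp only: module_vec_simps)

lemma binary_code_zero:
  assumes "binary_code n k C"
  shows "0\<^sub>v n \<in> C"
  using submodule.zero_closed[OF binary_code_submodule[OF assms]] by (simp only: module_vec_simps)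

lemma binary_code_add:
  assumes "binary_code n k C" "x \<in> C" "y \<in> C"
  shows "x + y \<in> C"
  using submodule.m_closed[OF binary_code_submodule[OF assms(1)] assms(2,3)]
  by (simp only: module_vec_simps)

lemma binary_code_finite:
  assumes "binary_code n k C"
  shows "finite C"
  using binary_code_subset[OF assms] finite_carrier_vec_bit finite_subset by blast

lemma card_binary_code:
  assumes "binary_code n k C"
  shows "card C = 2 ^ k"
proof -
  let ?V = "module_vec TYPE(bit) n"
  interpret V: vectorspace class_ring ?V
    by (rule vec_vs)
  have sub: "subspace class_ring C ?V"
    using assms by (simp add: binary_code_def)
  interpret W: vectorspace class_ring "?V\<lparr>carrier := C\<rparr>"
    by (rule V.subspace_is_vs[OF sub])
  \<comment> \<open>Finite dimension needs some finite generating set; the finite code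
    \<open>C\<close> itself serves.\<close>
  have "W.span C \<subseteq> carrier (?V\<lparr>carrier := C\<rparr>)"
    by (rule W.span_is_subset2) simp
  moreover have "C \<subseteq> W.span C"
    using W.in_own_span[of C] by simp
  ultimately have "W.gen_set C"
    by auto
  then have "W.fin_dim"
    unfolding W.fin_dim_def using binary_code_finite[OF assms] by auto
  from W.card_carrier_eq_power_dim[OF this] show ?thesis
    using assms by (simp add: binary_code_def class_ring_simps UNIV_bit numeral_2_eq_2)
qed

section \<open>First order Reed-Muller codes\<close>

lemma RM1_subset: "RM1 m \<subseteq> carrier_vec (2 ^ m)"
proof (induction m rule: RM1.induct)
  case (3 m)
  have append: "u @\<^sub>v w \<in> carrier_vec (2 ^ Suc (Suc m))"
    if "u \<in> carrier_vec (2 ^ Suc m)" "w \<in> carrier_vec (2 ^ Suc m)" for u w :: "bit vec"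
    using append_carrier_vec[OF that] by simp
  show ?case
  proof
    fix x assume "x \<in> RM1 (Suc (Suc m))"
    then obtain u where u: "u \<in> RM1 (Suc m)"
      and x: "x = u @\<^sub>v u \<or> x = u @\<^sub>v (u + all_one_vec (2 ^ Suc m))"
      by auto
    have "u \<in> carrier_vec (2 ^ Suc m)"
      using 3 u by blast
    moreover from this have "u + all_one_vec (2 ^ Suc m) \<in> carrier_vec (2 ^ Suc m)"
      by (simp add: all_one_vec_def)
    ultimately show "x \<in> carrier_vec (2 ^ Suc (Suc m))"
      using x append by blast
  qed
qed simp_all

lemma all_one_vec_in_RM1: "all_one_vec (2 ^ m) \<in> RM1 m"
proof (induction m rule: RM1.induct)
  case (3 m)
  have "all_one_vec (2 ^ Suc (Suc m)) = all_one_vec (2 ^ Suc m) @\<^sub>v all_one_vec (2 ^ Suc m)"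
    by (rule eq_vecI) (auto simp: all_one_vec_def)
  with 3 show ?case
    by auto
qed (auto simp: all_one_vec_def)

text \<open>Induction over the two halves of a word. Coordinates whose offsets within their halves
  differ are separated by a doubled word (u,u), with u from the induction hypothesis; equal offsets
  in different halves are separated by (1,0).\<close>

lemma RM1_separates:
  assumes "i < j" "j < 2 ^ m"
  shows "\<exists>r\<in>RM1 m. r $ i \<noteq> r $ j"
  using assms
proof (induction m arbitrary: i j rule: RM1.induct)
  case 1
  then show ?case by simp
next
  case 2
  then have "unit_vec 2 0 \<in> RM1 (Suc 0)" "(unit_vec 2 0 :: bit vec) $ i \<noteq> unit_vec 2 0 $ j"
    by auto
  then show ?case by blast
next
  case (3 m)
  let ?h = "2 ^ Suc m :: nat"
  have dim: "dim_vec u = ?h" if "u \<in> RM1 (Suc m)" for u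
    using RM1_subset that by (metis carrier_vecD subsetD)
  have double: "\<exists>r\<in>RM1 (Suc (Suc m)). r $ i \<noteq> r $ j"
    if "u \<in> RM1 (Suc m)" "(u @\<^sub>v u) $ i \<noteq> (u @\<^sub>v u) $ j" for u
    using that by auto
  have less: "i < 2 * ?h" "j < 2 * ?h"
    using 3 by auto
  \<comment> \<open>The cases are: both in the left half, both in the right half, and different
    halves with the offset of \<open>i\<close> below, above or equal to that of \<open>j\<close>.
    The third and fourth are split because the induction hypothesis wants an ordered pair.\<close>
  consider "j < ?h" | "?h \<le> i" | "i < ?h" "?h \<le> j" "i < j - ?h"
    | "i < ?h" "?h \<le> j" "j - ?h < i" | "i < ?h" "j = i + ?h"
    by linarith
  then show ?case
  proof cases
    case 1
    then obtain u where "u \<in> RM1 (Suc m)" "u $ i \<noteq> u $ j"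
      using "3.IH" "3.prems" by blast
    then show ?thesis
      using double[of u] dim[of u] 1 "3.prems" by simp
  next
    case 2
    have "i - ?h < j - ?h" "j - ?h < ?h"
      using 2 less "3.prems" by auto
    then obtain u where "u \<in> RM1 (Suc m)" "u $ (i - ?h) \<noteq> u $ (j - ?h)"
      using "3.IH" by blast
    then show ?thesis
      using double[of u] dim[of u] 2 less "3.prems" by simp
  next
    case 3
    then have "j - ?h < ?h" using less by auto
    with 3 obtain u where "u \<in> RM1 (Suc m)" "u $ i \<noteq> u $ (j - ?h)"
      using "3.IH" by blast
    then show ?thesis
      using double[of u] dim[of u] 3 less by simp
  next
    case 4
    then obtain u where "u \<in> RM1 (Suc m)" "u $ (j - ?h) \<noteq> u $ i"
      using "3.IH" by blast
    then show ?thesis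
      using double[of u] dim[of u] 4 less by simp
  next
    case 5
    \<comment> \<open>Over F_2 the right half \<open>?u + ?u\<close> vanishes, so \<open>?r\<close>
      is the word (1,0).\<close>
    let ?u = "all_one_vec ?h"
    let ?r = "?u @\<^sub>v (?u + ?u)"
    have "?r \<in> RM1 (Suc (Suc m))"
      using all_one_vec_in_RM1[of "Suc m"] by auto
    moreover have "?r $ i \<noteq> ?r $ j"
      using 5 less by (simp add: all_one_vec_def)
    ultimately show ?thesis by blast
  qed
qed

section \<open>Signs, weights and complements\<close>

definition bit_sign :: "bit \<Rightarrow> real" where
  "bit_sign b = (if b = 0 then 1 else - 1)"

lemma bit_sign_add: "bit_sign (b + c) = bit_sign b * bit_sign c"
  by (cases b; cases c) (auto simp: bit_sign_def)

lemma bit_sign_mult_self: "bit_sign b * bit_sign b = 1"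
  by (simp add: bit_sign_def)

text \<open>Each nonzero coordinate turns a summand 1 into -1 and so lowers the sum by 2.\<close>

lemma sum_bit_sign:
  assumes "x \<in> carrier_vec n"
  shows "(\<Sum>i<n. bit_sign (x $ i)) = real n - 2 * real (wt x)"
proof -
  have "{i. i < dim_vec x \<and> x $ i \<noteq> 0} = {i \<in> {..<n}. x $ i \<noteq> 0}"
    using assms by auto
  then have wt: "real (wt x) = (\<Sum>i<n. of_bool (x $ i \<noteq> 0))"
    by (simp add: wt_def Int_def)
  have "(\<Sum>i<n. bit_sign (x $ i)) = (\<Sum>i<n. 1 - 2 * of_bool (x $ i \<noteq> 0))"
    by (intro sum.cong) (auto simp: bit_sign_def)
  also have "\<dots> = real n - 2 * real (wt x)"
    unfolding wt by (simp add: sum_subtractf sum_distrib_left)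
  finally show ?thesis .
qed

lemma wt_le:
  assumes "x \<in> carrier_vec n"
  shows "wt x \<le> n"
proof -
  have "wt x \<le> card {..<n}"
    unfolding wt_def using assms by (intro card_mono) auto
  then show ?thesis by simp
qed

lemma wt_eq_0_iff:
  assumes "x \<in> carrier_vec n"
  shows "wt x = 0 \<longleftrightarrow> x = 0\<^sub>v n"
proof
  assume "wt x = 0"
  then have "\<forall>i<n. x $ i = 0"
    using assms by (auto simp: wt_def)
  then show "x = 0\<^sub>v n"
    using assms by (intro eq_vecI) auto
qed (auto simp: wt_def)

lemma wt_add_all_one_vec:
  assumes "x \<in> carrier_vec n"
  shows "wt (x + all_one_vec n) = n - wt x"
proof -
  let ?S = "{i. i < dim_vec x \<and> x $ i \<noteq> 0}"
  have "{i. i < dim_vec (x + all_one_vec n) \<and> (x + all_one_vec n) $ i \<noteq> 0} = {..<n} - ?S"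
    using assms by (auto simp: all_one_vec_def)
  then have "wt (x + all_one_vec n) = card ({..<n} - ?S)"
    by (simp only: wt_def)
  also have "\<dots> = n - wt x"
    using assms by (subst card_Diff_subset) (auto simp: wt_def)
  finally show ?thesis .
qed

lemma add_self_bit_vec:
  assumes "x \<in> carrier_vec n" "r \<in> carrier_vec n"
  shows "(x + r) + r = (x :: bit vec)"
  using assms by (intro eq_vecI) (auto simp: add.assoc)

text \<open>Adding the all-one word is an involution of \<open>C\<close> that exchanges the weights
  i and n - i.\<close>

lemma num_words_complement:
  assumes C: "binary_code n k C" "all_one_vec n \<in> C" and "i \<le> n"
  shows "num_words C (n - i) = num_words C i"
proof -
  note carrier = subsetD[OF binary_code_subset[OF C(1)]]
  have "bij_betw (\<lambda>x. x + all_one_vec n) {x \<in> C. wt x = n - i} {x \<in> C. wt x = i}"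
    by (rule bij_betw_byWitness[where f' = "\<lambda>x. x + all_one_vec n"])
      (auto simp: carrier C binary_code_add[OF C(1)] add_self_bit_vec[of _ n]
        wt_add_all_one_vec[of _ n] \<open>i \<le> n\<close>)
  then show ?thesis
    unfolding num_words_def by (rule bij_betw_same_card)
qed

lemma num_words_0:
  assumes "binary_code n k C"
  shows "num_words C 0 = 1"
proof -
  have "{x \<in> C. wt x = 0} = {0\<^sub>v n}"
    using binary_code_zero[OF assms]
    by (auto simp: wt_eq_0_iff[OF subsetD[OF binary_code_subset[OF assms]]])
  then show ?thesis
    by (simp add: num_words_def)
qed

section \<open>Moments of the weights\<close>

lemma sum_bit_sign_product_eq_0:
  assumes C: "binary_code n k C" and r: "r \<in> C" "r $ i \<noteq> r $ j" and ij: "i < n" "j < n"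
  shows "(\<Sum>x\<in>C. bit_sign (x $ i) * bit_sign (x $ j)) = 0"
proof -
  note carrier = subsetD[OF binary_code_subset[OF C]]
  have sign: "bit_sign (r $ i) * bit_sign (r $ j) = - 1"
    using r(2) by (cases "r $ i"; cases "r $ j") (auto simp: bit_sign_def)
  \<comment> \<open>Translation by \<open>r\<close> permutes \<open>C\<close>, and it negates every
    summand because exactly one of the two signs changes. The real sum thus equals its own
    negative.\<close>
  have "(\<Sum>x\<in>C. bit_sign (x $ i) * bit_sign (x $ j)) =
      (\<Sum>x\<in>C. bit_sign ((x + r) $ i) * bit_sign ((x + r) $ j))"
    by (rule sum.reindex_bij_witness[where i = "\<lambda>x. x + r" and j = "\<lambda>x. x + r"])
      (auto simp: binary_code_add[OF C] r carrier add_self_bit_vec[of _ n])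
  also have "\<dots> = (\<Sum>x\<in>C. - (bit_sign (x $ i) * bit_sign (x $ j)))"
  proof (rule sum.cong)
    fix x assume "x \<in> C"
    have index: "(x + r) $ l = x $ l + r $ l" if "l < n" for l
      using carrier[OF r(1)] that by simp
    have "bit_sign ((x + r) $ i) * bit_sign ((x + r) $ j) =
        (bit_sign (x $ i) * bit_sign (x $ j)) * (bit_sign (r $ i) * bit_sign (r $ j))"
      unfolding index[OF ij(1)] index[OF ij(2)] bit_sign_add by (simp only: mult_ac)
    then show "bit_sign ((x + r) $ i) * bit_sign ((x + r) $ j) =
        - (bit_sign (x $ i) * bit_sign (x $ j))"
      by (simp add: sign)
  qed simp
  finally show ?thesis
    by (simp add: sum_negf)
qed

lemma second_moment_binary_code:
  assumes C: "binary_code n k C"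
    and sep: "\<And>i j. i < j \<Longrightarrow> j < n \<Longrightarrow> \<exists>r\<in>C. r $ i \<noteq> r $ j"
  shows "(\<Sum>x\<in>C. (real n - 2 * real (wt x))\<^sup>2) = real n * real (card C)"
proof -
  have sep': "\<exists>r\<in>C. r $ i \<noteq> r $ j" if "i \<noteq> j" "i < n" "j < n" for i j
    using sep[of i j] sep[of j i] that by (metis nat_neq_iff)
  have "(\<Sum>x\<in>C. (real n - 2 * real (wt x))\<^sup>2) =
      (\<Sum>x\<in>C. \<Sum>i<n. \<Sum>j<n. bit_sign (x $ i) * bit_sign (x $ j))"
    using binary_code_subset[OF C]
    by (intro sum.cong) (auto simp: power2_eq_square sum_product simp flip: sum_bit_sign)
  also have "\<dots> = (\<Sum>i<n. \<Sum>j<n. \<Sum>x\<in>C. bit_sign (x $ i) * bit_sign (x $ j))"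
    by (subst sum.swap, rule sum.cong[OF refl], rule sum.swap)
  also have "\<dots> = (\<Sum>i<n. \<Sum>j<n. if i = j then real (card C) else 0)"
  proof (intro sum.cong refl)
    fix i j assume "i \<in> {..<n}" "j \<in> {..<n}"
    then show "(\<Sum>x\<in>C. bit_sign (x $ i) * bit_sign (x $ j)) = (if i = j then real (card C) else 0)"
      using sep'[of i j] sum_bit_sign_product_eq_0[OF C]
      by (cases "i = j") (auto simp: bit_sign_mult_self)
  qed
  also have "\<dots> = real n * real (card C)"
    by simp
  finally show ?thesis .
qed

text \<open>Codewords are grouped by weight; \<open>S\<close> only has to cover the weights that
  occur, since any other index contributes 0.\<close>

lemma sum_wt_eq_sum_num_words:
  fixes f :: "nat \<Rightarrow> real"
  assumes C: "binary_code n k C" and S: "finite S" "\<And>i. i \<le> n \<Longrightarrow> num_words C i \<noteq> 0 \<Longrightarrow> i \<in> S"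
  shows "(\<Sum>x\<in>C. f (wt x)) = (\<Sum>i\<in>S. real (num_words C i) * f i)"
proof -
  have "wt ` C \<subseteq> S"
  proof
    fix i assume "i \<in> wt ` C"
    then obtain x where x: "x \<in> C" "wt x = i" by auto
    then have "num_words C i \<noteq> 0"
      using binary_code_finite[OF C] by (auto simp: num_words_def)
    moreover have "i \<le> n"
      using wt_le binary_code_subset[OF C] x by blast
    ultimately show "i \<in> S" by (rule S(2)[rotated])
  qed
  then have "(\<Sum>x\<in>C. f (wt x)) = (\<Sum>i\<in>S. \<Sum>x\<in>{x \<in> C. wt x = i}. f (wt x))"
    by (intro sum.group[symmetric] binary_code_finite[OF C] S(1))
  also have "\<dots> = (\<Sum>i\<in>S. real (num_words C i) * f i)"
    by (intro sum.cong) (simp_all add: num_words_def)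
  finally show ?thesis .
qed

section \<open>Solving for the weight distribution\<close>

theorem proposition2:
  fixes n m k a :: nat and C :: "bit vec set" and l :: real
  assumes "m \<ge> 2" and "n = 2 ^ m"
    and "binary_code n k C"
    and "0 < a" and "a < n div 2"
    and "{i \<in> {0..n}. num_words C i \<noteq> 0} = {0, n div 2 - a, n div 2, n div 2 + a, n}"
    and "RM1 m \<subseteq> C"
    and "l = (real n / (2 * real a)) ^ 2"
  shows "num_words C 0 = 1 \<and>
    real (num_words C (n div 2 - a)) = (2 ^ (k - m - 1) - 1) * l \<and>
    real (num_words C (n div 2)) =
           2 * real n - 2 + (2 ^ (k - m - 1) - 1) * (2 * real n - 2 * l) \<and>
    real (num_words C (n div 2 + a)) = (2 ^ (k - m - 1) - 1) * l \<and>
    num_words C n = 1"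
proof -
  note C = assms(3)
  define h where "h = n div 2"
  have n: "n = 2 * h"
    unfolding h_def assms(2) using assms(1) by (cases m) auto
  have h: "0 < a" "a < h"
    using assms(4,5) by (simp_all add: h_def)
  have one: "all_one_vec n \<in> C"
    using all_one_vec_in_RM1 assms(2,7) by blast
  have sep: "\<exists>r\<in>C. r $ i \<noteq> r $ j" if "i < j" "j < n" for i j
    using RM1_separates[of i j m] assms(2,7) that by blast
  have A0: "num_words C 0 = 1"
    by (rule num_words_0[OF C])
  have An: "num_words C n = 1"
    using num_words_complement[OF C one, of 0] A0 by simp
  have sym: "num_words C (h + a) = num_words C (h - a)"
    using num_words_complement[OF C one, of "h - a"] n h by simp
  define A where "A = real (num_words C (h - a))"
  define N where "N = real n"
  define q where "q = (2 :: real) ^ k"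
  let ?S = "{0, h - a, h, h + a, n}"
  have S: "i \<in> ?S" if "i \<le> n" "num_words C i \<noteq> 0" for i
  proof -
    have "i \<in> {i \<in> {0..n}. num_words C i \<noteq> 0}"
      using that by simp
    then show ?thesis
      unfolding assms(6) h_def .
  qed
  \<comment> \<open>With both end counts equal to 1 and the symmetry \<open>sym\<close>, only
    \<open>A\<close> and \<open>num_words C h\<close> remain unknown.\<close>
  have expand: "(\<Sum>x\<in>C. f (wt x)) =
      f 0 + A * f (h - a) + real (num_words C h) * f h + A * f (h + a) + f n"
    for f :: "nat \<Rightarrow> real"
  proof -
    have "(\<Sum>x\<in>C. f (wt x)) = (\<Sum>i\<in>?S. real (num_words C i) * f i)"
      by (rule sum_wt_eq_sum_num_words[OF C _ S]) auto
    \<comment> \<open>The five weights are distinct because 0 < a < h, so the sum over the set has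
      exactly five terms.\<close>
    moreover have "0 \<notin> {h - a, h, h + a, n}" "h - a \<notin> {h, h + a, n}" "h \<notin> {h + a, n}" "h + a \<notin> {n}"
      using n h by auto
    then have "(\<Sum>i\<in>?S. real (num_words C i) * f i) = f 0 + A * f (h - a) + real (num_words C h) * f h + A * f (h + a) + f n"
      by (simp add: A0 An sym A_def del: insert_iff)
    ultimately show ?thesis by simp
  qed
  have count: "q = 2 + 2 * A + real (num_words C h)"
    using expand[of "\<lambda>_. 1"] card_binary_code[OF C] by (simp add: q_def)
  have "N * q = (\<Sum>x\<in>C. (real n - 2 * real (wt x))\<^sup>2)"
    using second_moment_binary_code[OF C sep] card_binary_code[OF C] by (simp add: N_def q_def)
  \<comment> \<open>Weights 0 and n contribute N^2 each, each word of weight h - a or h + a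
    contributes (2a)^2, and weight h contributes 0.\<close>
  also have "\<dots> = 2 * N\<^sup>2 + 8 * A * (real a)\<^sup>2"
    unfolding expand[of "\<lambda>i. (real n - 2 * real i)\<^sup>2"] using n h by (simp add: N_def of_nat_diff power2_eq_square algebra_simps)
  finally have moment: "N * q = 2 * N\<^sup>2 + 8 * A * (real a)\<^sup>2" .
  have N: "N > 0"
    using n h by (simp add: N_def)
  \<comment> \<open>Nonnegativity of \<open>A\<close> in \<open>moment\<close> forces 2N \<le> q,
    that is m + 1 \<le> k, so the natural subtraction in \<open>k - m - 1\<close> is not
    truncated.\<close>
  have "A \<ge> 0"
    by (simp add: A_def)
  then have "N * (2 * N) \<le> N * q"
    using moment by (simp add: power2_eq_square)
  then have "2 * N \<le> q"
    using N by simp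
  then have "(2 :: real) ^ Suc m \<le> 2 ^ k"
    by (simp add: N_def q_def assms(2))
  then have "Suc m \<le> k"
    by (subst (asm) power_increasing_iff) auto
  then have "q = 2 ^ (k - m - 1) * 2 ^ Suc m"
    unfolding q_def by (simp only: flip: power_add) simp
  then have q: "q = 2 ^ (k - m - 1) * (2 * N)"
    by (simp add: N_def assms(2))
  \<comment> \<open>Inserting \<open>q\<close> into \<open>moment\<close> gives 8 A a^2 = 2 N^2
    (2^(k-m-1) - 1), and l = N^2 / (4 a^2).\<close>
  have "A = (2 ^ (k - m - 1) - 1) * l"
    using moment h unfolding q assms(8) N_def[symmetric]
    by (simp add: field_simps power2_eq_square)
  moreover from this count have "real (num_words C h) =
      2 * N - 2 + (2 ^ (k - m - 1) - 1) * (2 * N - 2 * l)"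
    unfolding q by (simp add: algebra_simps)
  ultimately show ?thesis
    using A0 An sym unfolding A_def N_def h_def by simp
qed

end
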